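(* Let $G$ be a finite solvable group, let $H$ be a non-normal maximal subgroup of $G$, and let $q \in \pi(F(H/\mathrm{Core}_G H))$. Then $G$ has a Sylow $q$-subgroup $Q$ such that $N_G(Q) \subseteq H$.
   Context: All groups are finite. $F(X)$ denotes the Fitting subgroup of a group $X$; $\pi(Y)$ denotes the set of all prime divisors of $|Y|$ for a finite group $Y$; $\mathrm{Core}_G H = \bigcap_{g\in G} H^g$ is the largest normal subgroup of $G$ contained in $H$; $N_G(Q)$ is the normalizer of $Q$ in $G$. *)

theory Defs
  imports "HOL-Algebra.Algebra"
begin

definition maximal_subgroup :: "'a set \<Rightarrow> ('a, 'b) monoid_scheme \<Rightarrow> bool" where
  "maximal_subgroup H G \<longleftrightarrow>
     subgroup H G \<and> H \<noteq> carrier G \<and>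
     (\<forall>K. subgroup K G \<and> H \<subseteq> K \<longrightarrow> K = H \<or> K = carrier G)"

definition normal_core :: "('a, 'b) monoid_scheme \<Rightarrow> 'a set \<Rightarrow> 'a set" where
  "normal_core G H = (\<Inter>g\<in>carrier G. inv\<^bsub>G\<^esub> g <#\<^bsub>G\<^esub> H #>\<^bsub>G\<^esub> g)"

definition sylow_subgroup :: "('a, 'b) monoid_scheme \<Rightarrow> nat \<Rightarrow> 'a set \<Rightarrow> bool" where
  "sylow_subgroup G p P \<longleftrightarrow>
     Factorial_Ring.prime p \<and> subgroup P G \<and> card P = p ^ multiplicity p (order G)"

definition commutator_subgroup :: "('a, 'b) monoid_scheme \<Rightarrow> 'a set \<Rightarrow> 'a set \<Rightarrow> 'a set" where
  "commutator_subgroup G A B =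
     generate G (\<Union>a\<in>A. \<Union>b\<in>B. {a \<otimes>\<^bsub>G\<^esub> b \<otimes>\<^bsub>G\<^esub> inv\<^bsub>G\<^esub> a \<otimes>\<^bsub>G\<^esub> inv\<^bsub>G\<^esub> b})"

primrec lower_central_series :: "('a, 'b) monoid_scheme \<Rightarrow> nat \<Rightarrow> 'a set" where
  "lower_central_series G 0 = carrier G"
| "lower_central_series G (Suc n) =
     commutator_subgroup G (lower_central_series G n) (carrier G)"

definition nilpotent_group :: "('a, 'b) monoid_scheme \<Rightarrow> bool" where
  "nilpotent_group G \<longleftrightarrow> group G \<and> (\<exists>n. lower_central_series G n = {\<one>\<^bsub>G\<^esub>})"

text \<open>The Fitting subgroup is the subgroup generated by all nilpotent normal subgroups.
  For finite \<open>G\<close> it is itself nilpotent (Fitting's theorem), hence the largest of them.\<close>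

definition fitting_subgroup :: "('a, 'b) monoid_scheme \<Rightarrow> 'a set" where
  "fitting_subgroup G =
     generate G (\<Union>{N. N \<lhd> G \<and> nilpotent_group (G\<lparr>carrier := N\<rparr>)})"

end

theory Submission
  imports Defs
begin

text \<open>Let \<open>C = Core\<^sub>G H\<close>, \<open>G' = G / C\<close> and \<open>H' = H / C\<close>. The group \<open>G'\<close> is solvable and nontrivial, so it
  has an abelian minimal normal subgroup \<open>A\<close> (\<open>abelian_normal_minimal\<close>). Since \<open>H'\<close> is maximal with
  trivial core, \<open>G' = A H'\<close>, and the subgroups \<open>A \<inter> H'\<close> and \<open>C\<^bsub>H'\<^esub>(A)\<close>, being normal in \<open>G'\<close> and
  contained in \<open>H'\<close>, are trivial.

  Because \<open>q\<close> divides \<open>|F(H')|\<close>, the group \<open>H'\<close> has a normal \<open>q\<close>-subgroup \<open>R \<noteq> 1\<close>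
  (\<open>prime_dvd_fitting_imp_normal_prime_power\<close>); this rests on the fact that a nilpotent group of
  order divisible by \<open>q\<close> has a central element of order \<open>q\<close> (\<open>nilpotent_central_torsion\<close>). The
  centralizer \<open>C\<^bsub>A\<^esub>(R)\<close> is normal in \<open>A H' = G'\<close>, and it is not \<open>A\<close>, as \<open>R\<close> does not centralize
  \<open>A\<close>; by minimality it is trivial (\<open>centralizer_R_in_A\<close>). This has two consequences.

  First, \<open>R\<close> acts on \<open>A\<close> with \<open>\<one>\<close> as its only fixed point, so \<open>q\<close> does not divide \<open>|A|\<close>. The
  index of \<open>H\<close> in \<open>G\<close> divides \<open>|A|\<close>, so a Sylow \<open>q\<close>-subgroup \<open>Q\<close> of \<open>H\<close> is a Sylow \<open>q\<close>-subgroup of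
  \<open>G\<close> (\<open>index_coprime\<close>). Secondly, the image \<open>Q'\<close> of \<open>Q\<close> has index coprime to \<open>q\<close> in \<open>H'\<close> and
  therefore contains \<open>R\<close> (\<open>normal_prime_power_subset\<close>). If \<open>g = a h\<close> normalizes \<open>Q'\<close>, with \<open>a \<in> A\<close>
  and \<open>h \<in> H'\<close>, then conjugation by \<open>a\<close> maps \<open>R\<close> into \<open>Q' \<subseteq> H'\<close>, so \<open>[a, r] \<in> A \<inter> H' = 1\<close> for
  all \<open>r \<in> R\<close>. Thus \<open>a \<in> C\<^bsub>A\<^esub>(R) = 1\<close> and \<open>g \<in> H'\<close> (\<open>normalizing_imp_mem\<close>). Elements of \<open>N\<^bsub>G\<^esub>(Q)\<close>
  normalize \<open>Q'\<close> modulo \<open>C\<close>, and \<open>C \<subseteq> H\<close>, so \<open>N\<^bsub>G\<^esub>(Q) \<subseteq> H\<close>.\<close>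

section \<open>Commuting elements\<close>

lemma (in group) commutator_eq_one_iff:
  assumes "x \<in> carrier G" "y \<in> carrier G"
  shows "x \<otimes> y \<otimes> inv x \<otimes> inv y = \<one> \<longleftrightarrow> x \<otimes> y = y \<otimes> x"
  using assms by (simp add: inv_solve_right')

lemma (in group) commutes_mult:
  assumes "a \<in> carrier G" "b \<in> carrier G" "y \<in> carrier G"
    and "a \<otimes> y = y \<otimes> a" "b \<otimes> y = y \<otimes> b"
  shows "a \<otimes> b \<otimes> y = y \<otimes> (a \<otimes> b)"
  using assms by (metis m_assoc)

lemma (in group) commutes_inv:
  assumes "a \<in> carrier G" "y \<in> carrier G" and "a \<otimes> y = y \<otimes> a"
  shows "inv a \<otimes> y = y \<otimes> inv a"
proof -
  have "inv a \<otimes> y = inv a \<otimes> (y \<otimes> a) \<otimes> inv a" using assms(1,2) by (simp add: m_assoc)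
  also have "\<dots> = inv a \<otimes> (a \<otimes> y) \<otimes> inv a" using assms(3) by simp
  also have "\<dots> = y \<otimes> inv a" using assms(1,2) by (simp add: m_assoc[symmetric])
  finally show ?thesis .
qed

lemma (in group) conj_eq_self:
  assumes "a \<in> carrier G" "m \<in> carrier G" "a \<otimes> m = m \<otimes> a"
  shows "a \<otimes> m \<otimes> inv a = m"
  using assms by (simp add: m_assoc)

lemma (in group) subgroup_centralizer:
  assumes K: "subgroup K G" and S: "S \<subseteq> carrier G"
  shows "subgroup {x \<in> K. \<forall>s\<in>S. x \<otimes> s = s \<otimes> x} G" (is "subgroup ?C G")
proof (rule subgroupI)
  have "\<one> \<in> ?C" using S subgroup.one_closed[OF K] by auto
  thus "?C \<noteq> {}" by blast
  show "?C \<subseteq> carrier G" using subgroup.subset[OF K] by auto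
next
  fix a assume "a \<in> ?C"
  thus "inv a \<in> ?C"
    using commutes_inv[of a] S subgroup.m_inv_closed[OF K] subgroup.mem_carrier[OF K] by blast
next
  fix a b assume "a \<in> ?C" "b \<in> ?C"
  thus "a \<otimes> b \<in> ?C"
    using commutes_mult[of a b] S subgroup.m_closed[OF K] subgroup.mem_carrier[OF K] by blast
qed

lemma (in group) conj_commutes:
  assumes g: "g \<in> carrier G" and x: "x \<in> carrier G" and s: "s \<in> carrier G"
    and c: "x \<otimes> (inv g \<otimes> s \<otimes> g) = (inv g \<otimes> s \<otimes> g) \<otimes> x"
  shows "(g \<otimes> x \<otimes> inv g) \<otimes> s = s \<otimes> (g \<otimes> x \<otimes> inv g)"
proof -
  have "(g \<otimes> x \<otimes> inv g) \<otimes> s = g \<otimes> (x \<otimes> (inv g \<otimes> s \<otimes> g)) \<otimes> inv g"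
    using g x s by (simp add: m_assoc)
  also have "\<dots> = g \<otimes> ((inv g \<otimes> s \<otimes> g) \<otimes> x) \<otimes> inv g"
    by (simp only: c)
  also have "\<dots> = (g \<otimes> inv g) \<otimes> s \<otimes> (g \<otimes> x \<otimes> inv g)"
    using g x s by (simp only: m_assoc m_closed inv_closed)
  finally show ?thesis using g x s by simp
qed

section \<open>Orders of subgroups\<close>

lemma (in group) card_subgroup_dvd:
  assumes "subgroup K G" "subgroup L G" "K \<subseteq> L"
  shows "card K dvd card L"
  using dvdI[OF group.lagrange[OF subgroup_imp_group[OF assms(2)]
      subgroup_incl[OF assms(1,2,3)], symmetric, unfolded mult.commute[of _ "card K"]]]
  by (simp add: order_def)

text \<open>By the second isomorphism theorem the index of \<open>N\<close> in \<open>N K\<close> is that of \<open>N \<inter> K\<close> in \<open>K\<close>, a divisor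
  of \<open>|K|\<close>.\<close>

lemma (in group) card_normal_set_mult_dvd:
  assumes "N \<lhd> G" "subgroup K G"
  shows "card (N <#> K) dvd card N * card K"
proof -
  interpret second_isomorphism_grp N G K
    using assms by (simp add: second_isomorphism_grp_def second_isomorphism_grp_axioms_def)
  have sub: "subgroup (N <#> K) G" and N: "subgroup N G"
    using normal_set_mult_subgroup assms normal_imp_subgroup by auto
  have "card (N <#> K) = card (rcosets\<^bsub>G\<lparr>carrier := N <#> K\<rparr>\<^esub> N) * card N"
    using group.lagrange[OF subgroup_imp_group[OF sub]
        subgroup_incl[OF N sub H_contained_in_set_mult]]
    by (simp add: order_def)
  moreover have "card (rcosets\<^bsub>G\<lparr>carrier := N <#> K\<rparr>\<^esub> N)
      = card (rcosets\<^bsub>G\<lparr>carrier := K\<rparr>\<^esub> (N \<inter> K))"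
    using iso_same_card[OF is_isoI[OF normal_intersection_quotient_isom]]
    by (simp add: FactGroup_def)
  moreover have "card (rcosets\<^bsub>G\<lparr>carrier := K\<rparr>\<^esub> (N \<inter> K)) dvd card K"
    using dvdI[OF group.lagrange[OF subgroup_imp_group[OF assms(2)]
        subgroup_incl[OF subgroups_Inter_pair[OF N assms(2)] assms(2) inf_le2], symmetric]]
    by (simp add: order_def)
  ultimately show ?thesis
    by (simp add: mult.commute mult_dvd_mono)
qed

text \<open>A normal \<open>q\<close>-subgroup lies in every subgroup \<open>Q\<close> of index coprime to \<open>q\<close>, in particular in every
  Sylow \<open>q\<close>-subgroup: the index of \<open>Q\<close> in \<open>R Q\<close> divides both \<open>|R|\<close> and the index of \<open>Q\<close>.\<close>

lemma (in group) normal_prime_power_subset: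
  assumes fin: "finite (carrier G)" and q: "Factorial_Ring.prime q"
    and R: "R \<lhd> G" "card R = q ^ k"
    and Q: "subgroup Q G" and card: "card (carrier G) = card Q * s" "\<not> q dvd s"
  shows "R \<subseteq> Q"
proof -
  interpret second_isomorphism_grp R G Q
    using assms by (simp add: second_isomorphism_grp_def second_isomorphism_grp_axioms_def)
  have sub: "subgroup (R <#> Q) G"
    by (rule normal_set_mult_subgroup)
  have finQ: "finite Q" "card Q > 0"
    using subgroup.finite_imp_card_positive[OF Q fin] card_gt_0_iff by auto
  obtain t where t: "card (R <#> Q) = card Q * t"
    using card_subgroup_dvd[OF Q sub S_contained_in_set_mult] by (auto simp: dvd_def)
  have "card (R <#> Q) dvd card (carrier G)"
    using card_subgroup_dvd[OF sub subgroup_self] subgroup.subset[OF sub] by simp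
  hence "t dvd s" using t card finQ by (metis nat_mult_dvd_cancel1)
  moreover have "t dvd q ^ k"
    using card_normal_set_mult_dvd[OF R(1) Q] t R(2) finQ by (metis nat_mult_dvd_cancel1 mult.commute)
  then obtain i where i: "t = q ^ i" using divides_primepow_nat[OF q] by auto
  ultimately have "i = 0"
    using card(2) dvd_power[of i q] dvd_trans[of q "q ^ i" s] by (cases "i = 0") auto
  hence "t = 1" using i by simp
  hence "Q = R <#> Q"
    using t S_contained_in_set_mult fin subgroup.subset[OF sub]
    by (intro card_subset_eq) (auto intro: finite_subset)
  thus ?thesis using H_contained_in_set_mult by simp
qed

lemma (in group) cauchy:
  assumes fin: "finite (carrier G)" and q: "Factorial_Ring.prime q" and "q dvd card (carrier G)"
  shows "\<exists>x\<in>carrier G. x \<noteq> \<one> \<and> x [^] q = \<one>"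
proof -
  obtain m where "order G = q ^ 1 * m"
    using assms by (auto simp: order_def dvd_def)
  from sylow_thm[OF q is_group this fin] obtain K where K: "subgroup K G" "card K = q" by auto
  have "card K > 1" using K q prime_gt_1_nat by auto
  hence "\<not> K \<subseteq> {\<one>}" using card_mono[of "{\<one>}" K] by auto
  then obtain x where x: "x \<in> K" "x \<noteq> \<one>" by auto
  interpret K: group "G\<lparr>carrier := K\<rparr>" by (rule subgroup_imp_group[OF K(1)])
  have "x [^]\<^bsub>G\<lparr>carrier := K\<rparr>\<^esub> order (G\<lparr>carrier := K\<rparr>) = \<one>"
    using K.pow_order_eq_1[of x] x by simp
  hence "x [^] q = \<one>"
    using K(2) nat_pow_consistent[of x q K] by (simp add: order_def)
  thus ?thesis using x subgroup.mem_carrier[OF K(1)] by blast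
qed

lemma (in group) exponent_prime_imp_card_prime_power:
  assumes fin: "finite (carrier G)" and q: "Factorial_Ring.prime q"
    and e: "\<And>x. x \<in> carrier G \<Longrightarrow> x [^] q = \<one>"
  shows "\<exists>k. card (carrier G) = q ^ k"
proof -
  have pos: "card (carrier G) > 0"
    using fin by (auto simp: card_gt_0_iff)
  have only: "r = q" if r: "Factorial_Ring.prime r" "r dvd card (carrier G)" for r :: nat
  proof -
    obtain x where x: "x \<in> carrier G" "x \<noteq> \<one>" "x [^] r = \<one>" using cauchy[OF fin r] by auto
    have "ord x dvd r" "ord x dvd q" "ord x \<noteq> 1"
      using x e pow_eq_id ord_eq_1 by auto
    thus ?thesis using r(1) q unfolding prime_nat_iff by auto
  qed
  obtain m where m: "card (carrier G) = q ^ multiplicity q (card (carrier G)) * m" "\<not> q dvd m"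
  proof (rule multiplicity_decompose'[of "card (carrier G)" q])
    show "card (carrier G) \<noteq> 0" using pos by simp
    show "\<not> is_unit q" using q by (auto dest: not_prime_unit)
  qed
  have "m = 1"
  proof (rule ccontr)
    assume "m \<noteq> 1"
    then obtain r where r: "Factorial_Ring.prime r" "r dvd m" using prime_factor_nat by blast
    moreover have "r dvd card (carrier G)" by (subst m(1)) (simp add: r(2))
    ultimately show False using only m(2) by blast
  qed
  thus ?thesis using m by auto
qed

section \<open>Fixed points of prime power groups\<close>

text \<open>An orbit of a \<open>q\<close>-group has \<open>q\<close>-power length, and length \<open>1\<close> only at a fixed point. The invariant
  set \<open>U\<close> may be smaller than the set acted upon, so that the conjugation action on the whole
  group can be used for a normal subgroup.\<close>

lemma (in group_action) prime_dvd_card_moved_points: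
  assumes q: "Factorial_Ring.prime q" and G: "order G = q ^ k"
    and U: "finite U" "U \<subseteq> E" "\<And>g x. \<lbrakk>g \<in> carrier G; x \<in> U\<rbrakk> \<Longrightarrow> \<phi> g x \<in> U"
  shows "q dvd card (U - {x \<in> U. \<forall>g\<in>carrier G. \<phi> g x = x})"
proof -
  define V where "V = U - {x \<in> U. \<forall>g\<in>carrier G. \<phi> g x = x}"
  interpret group G using group_hom group_hom.axioms(1) by auto
  have VE: "V \<subseteq> E" using U V_def by auto
  have orbV: "orbit G \<phi> x \<subseteq> V" if x: "x \<in> V" for x
  proof
    fix y assume "y \<in> orbit G \<phi> x"
    then obtain g where g: "g \<in> carrier G" "y = \<phi> g x" by (auto simp: orbit_def)
    have xE: "x \<in> E" using x VE by auto
    have yU: "y \<in> U" using x g U V_def by auto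
    have gy: "\<phi> (inv g) y = x" using orbit_sym_aux[OF g(1) xE] g(2) by simp
    have "\<not> (\<forall>h\<in>carrier G. \<phi> h y = y)"
    proof
      assume fixed: "\<forall>h\<in>carrier G. \<phi> h y = y"
      hence "y = x" using gy g by force
      thus False using fixed x V_def by auto
    qed
    thus "y \<in> V" using yU V_def by auto
  qed
  have un: "\<Union>((orbit G \<phi>) ` V) = V" using orbV orbit_refl VE by blast
  have "q dvd card (\<Union>((orbit G \<phi>) ` V))"
  proof (rule dvd_partition)
    show "finite (\<Union> (orbit G \<phi> ` V))" using un U V_def by simp
    show "\<forall>c\<in>orbit G \<phi> ` V. q dvd card c"
    proof
      fix c assume "c \<in> orbit G \<phi> ` V"
      then obtain x where x: "x \<in> V" and c: "c = orbit G \<phi> x" by auto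
      have xE: "x \<in> E" using x VE by auto
      have "card c dvd q ^ k" using dvdI[OF orbit_stabilizer_theorem[OF xE, symmetric]] G c by simp
      then obtain i where i: "card c = q ^ i" using divides_primepow_nat[OF q] by auto
      have "i \<noteq> 0"
      proof
        assume "i = 0"
        hence "card c = 1" using i by simp
        then obtain z where z: "c = {z}" using card_1_singletonE by blast
        have "\<phi> g x = x" if "g \<in> carrier G" for g
        proof -
          have "\<phi> g x \<in> c" using that c by (auto simp: orbit_def)
          moreover have "x \<in> c" using orbit_refl[OF xE] c by simp
          ultimately show ?thesis using z by simp
        qed
        thus False using x V_def by auto
      qed
      thus "q dvd card c" using i by simp
    qed
    show "\<forall>c1\<in>orbit G \<phi> ` V. \<forall>c2\<in>orbit G \<phi> ` V. c1 \<noteq> c2 \<longrightarrow> c1 \<inter> c2 = {}"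
      using disjoint_union VE unfolding orbits_def by blast
  qed
  thus ?thesis using un V_def by simp
qed

lemma (in group) prime_dvd_card_noncentralized:
  assumes q: "Factorial_Ring.prime q" and R: "subgroup R G" "card R = q ^ k"
    and U: "finite U" "U \<subseteq> carrier G"
    and conj: "\<And>r u. \<lbrakk>r \<in> R; u \<in> U\<rbrakk> \<Longrightarrow> r \<otimes> u \<otimes> inv r \<in> U"
  shows "q dvd card (U - {u \<in> U. \<forall>r\<in>R. r \<otimes> u = u \<otimes> r})"
proof -
  let ?\<phi> = "\<lambda>g. \<lambda>h \<in> carrier G. g \<otimes> h \<otimes> inv g"
  have "group_hom G (BijGroup (carrier G)) ?\<phi>"
    using action_by_conjugation by (simp add: group_action_def)
  hence act: "group_action (G\<lparr>carrier := R\<rparr>) (carrier G) ?\<phi>"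
    unfolding group_action_def by (rule group_hom.induced_group_hom'[OF _ R(1)])
  have "q dvd card (U - {u \<in> U. \<forall>g\<in>carrier (G\<lparr>carrier := R\<rparr>). ?\<phi> g u = u})"
    by (rule group_action.prime_dvd_card_moved_points[OF act q])
       (use R U conj in \<open>auto simp: order_def\<close>)
  moreover have "(r \<otimes> u \<otimes> inv r = u) = (r \<otimes> u = u \<otimes> r)" if "r \<in> R" "u \<in> U" for r u
    using that U subgroup.mem_carrier[OF R(1)] by (auto simp: inv_solve_right' subset_iff)
  hence "{u \<in> U. \<forall>g\<in>carrier (G\<lparr>carrier := R\<rparr>). ?\<phi> g u = u} = {u \<in> U. \<forall>r\<in>R. r \<otimes> u = u \<otimes> r}"
    using U(2) by (intro Collect_cong conj_cong refl) (simp add: subset_iff)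
  ultimately show ?thesis by simp
qed

section \<open>Central torsion in nilpotent groups\<close>

lemma (in group) commutator_power:
  assumes "x \<in> carrier G" "y \<in> carrier G" "c \<in> carrier G"
    and c: "x \<otimes> y = c \<otimes> y \<otimes> x" and cx: "c \<otimes> x = x \<otimes> c"
  shows "x [^] (k::nat) \<otimes> y = c [^] k \<otimes> y \<otimes> x [^] k"
proof (induction k)
  case (Suc k)
  have ck: "x \<otimes> c [^] k = c [^] k \<otimes> x"
    using assms cx by (metis group_commutes_pow)
  have "x [^] Suc k \<otimes> y = x \<otimes> (x [^] k \<otimes> y)"
    using assms(1-3) by (subst nat_pow_Suc2) (simp_all add: m_assoc)
  also have "\<dots> = (x \<otimes> c [^] k) \<otimes> y \<otimes> x [^] k"
    using assms(1-3) Suc by (simp add: m_assoc)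
  also have "\<dots> = c [^] k \<otimes> (x \<otimes> y) \<otimes> x [^] k"
    using assms(1-3) ck by (simp add: m_assoc)
  also have "\<dots> = (c [^] k \<otimes> c) \<otimes> y \<otimes> (x \<otimes> x [^] k)"
    using assms(1-3) c by (simp add: m_assoc)
  finally show ?case using assms(1) nat_pow_Suc2[of x k] by simp
qed (use assms(1-3) in simp)

lemma (in normal) rcos_commutator:
  assumes "x \<in> carrier G" "y \<in> carrier G"
  shows "H #> (x \<otimes> y \<otimes> inv x \<otimes> inv y)
    = (H #> x) \<otimes>\<^bsub>G Mod H\<^esub> (H #> y) \<otimes>\<^bsub>G Mod H\<^esub> inv\<^bsub>G Mod H\<^esub> (H #> x) \<otimes>\<^bsub>G Mod H\<^esub> inv\<^bsub>G Mod H\<^esub> (H #> y)"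
  using assms by (simp add: inv_FactGroup carrier_FactGroup rcos_inv rcos_sum)

lemma (in normal) rcos_eq_self_iff:
  assumes "x \<in> carrier G"
  shows "H #> x = H \<longleftrightarrow> x \<in> H"
  using assms coset_join1 coset_join2 subgroup_axioms by blast

lemma (in normal) commutator_mem_iff:
  assumes "x \<in> carrier G" "y \<in> carrier G"
  shows "x \<otimes> y \<otimes> inv x \<otimes> inv y \<in> H
    \<longleftrightarrow> (H #> x) \<otimes>\<^bsub>G Mod H\<^esub> (H #> y) = (H #> y) \<otimes>\<^bsub>G Mod H\<^esub> (H #> x)"
proof -
  interpret Q: group "G Mod H" by (rule factorgroup_is_group)
  have "H #> x \<in> carrier (G Mod H)" "H #> y \<in> carrier (G Mod H)"
    using assms by (auto simp: carrier_FactGroup)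
  from Q.commutator_eq_one_iff[OF this] show ?thesis
    using assms rcos_eq_self_iff[of "x \<otimes> y \<otimes> inv x \<otimes> inv y"] rcos_commutator[OF assms] by simp
qed

lemma (in group) center_normal:
  "{x \<in> carrier G. \<forall>y\<in>carrier G. x \<otimes> y = y \<otimes> x} \<lhd> G" (is "?Z \<lhd> G")
proof (rule normal_invI)
  show "subgroup ?Z G"
  proof (rule subgroupI)
    fix a b assume "a \<in> ?Z" "b \<in> ?Z"
    thus "a \<otimes> b \<in> ?Z" using commutes_mult[of a b] by blast
  next
    fix a assume "a \<in> ?Z"
    thus "inv a \<in> ?Z" using commutes_inv[of a] by blast
  qed (auto intro: exI[of _ \<one>])
  fix g z assume "g \<in> carrier G" "z \<in> ?Z"
  moreover from this have "z \<otimes> g = g \<otimes> z" by blast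
  ultimately show "g \<otimes> z \<otimes> inv g \<in> ?Z" using inv_solve_right'[of z "g \<otimes> z" g] by simp
qed

text \<open>The upper central series. Its terms are described by commutators in \<open>G\<close> itself and not as
  preimages of centres of quotients, which keeps all terms in one type and matches the
  commutators in the lower central series.\<close>

primrec upper_central_series :: "('a, 'b) monoid_scheme \<Rightarrow> nat \<Rightarrow> 'a set" where
  "upper_central_series G 0 = {\<one>\<^bsub>G\<^esub>}"
| "upper_central_series G (Suc n) = {x \<in> carrier G. \<forall>y\<in>carrier G.
     x \<otimes>\<^bsub>G\<^esub> y \<otimes>\<^bsub>G\<^esub> inv\<^bsub>G\<^esub> x \<otimes>\<^bsub>G\<^esub> inv\<^bsub>G\<^esub> y \<in> upper_central_series G n}"

lemma (in group) upper_central_series_normal: "upper_central_series G n \<lhd> G"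
proof (induction n)
  case 0
  show ?case by (simp add: one_is_normal)
next
  case (Suc n)
  let ?Z = "upper_central_series G n"
  interpret Z: normal ?Z G by (rule Suc)
  let ?Q = "G Mod ?Z"
  let ?C = "{S \<in> carrier ?Q. \<forall>T\<in>carrier ?Q. S \<otimes>\<^bsub>?Q\<^esub> T = T \<otimes>\<^bsub>?Q\<^esub> S}"
  have C: "?C \<lhd> G Mod ?Z"
    by (rule group.center_normal[OF Z.factorgroup_is_group])
  have "upper_central_series G (Suc n) = {x \<in> carrier G. ?Z #> x \<in> ?C}"
    by (auto simp: Z.commutator_mem_iff carrier_FactGroup)
  also have "\<dots> = \<Union>?C"
    by (rule Z.factgroup_subgroup_union_char[OF normal_imp_subgroup[OF C], symmetric])
  also have "\<dots> \<lhd> G" by (rule Z.factgroup_subgroup_union_normal[OF C])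
  finally show ?case .
qed

lemma (in group) lower_central_series_subset: "lower_central_series G n \<subseteq> carrier G"
proof (induction n)
  case (Suc n)
  thus ?case unfolding lower_central_series.simps commutator_subgroup_def
    by (intro generate_incl) (auto simp: subset_iff)
qed simp

lemma (in group) lower_central_series_subset_upper:
  assumes "lower_central_series G n = {\<one>}" "i \<le> n"
  shows "lower_central_series G (n - i) \<subseteq> upper_central_series G i"
  using assms(2)
proof (induction i)
  case 0
  thus ?case using assms by simp
next
  case (Suc i)
  have n: "n - i = Suc (n - Suc i)" using Suc by simp
  have "x \<otimes> y \<otimes> inv x \<otimes> inv y \<in> upper_central_series G i"
    if "x \<in> lower_central_series G (n - Suc i)" "y \<in> carrier G" for x y
  proof -
    have "x \<otimes> y \<otimes> inv x \<otimes> inv y \<in> lower_central_series G (n - i)"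
      using that unfolding n lower_central_series.simps commutator_subgroup_def
      by (intro generate.incl) auto
    thus ?thesis using Suc by auto
  qed
  thus ?case using lower_central_series_subset by auto
qed

text \<open>If \<open>z\<^sup>q = \<one>\<close> holds in the centre only for \<open>z = \<one>\<close>, then the same is true in every factor of
  the upper central series \<open>Z\<^sub>0 \<le> Z\<^sub>1 \<le> \<dots>\<close>. For \<open>x\<close> in the term \<open>n + 2\<close>, the commutator \<open>c = [x, y]\<close> is
  central modulo the term \<open>n\<close>, so that \<open>[x\<^sup>q, y] = c\<^sup>q\<close> there. If \<open>x\<^sup>q\<close> lies in the term \<open>n + 1\<close>, then
  \<open>c\<^sup>q\<close> lies in the term \<open>n\<close>, and so does \<open>c\<close> by induction; as \<open>y\<close> is arbitrary, \<open>x\<close> lies in the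
  term \<open>n + 1\<close>.\<close>

lemma (in group) upper_central_series_torsion:
  assumes center: "\<And>z. \<lbrakk>z \<in> carrier G; \<forall>y\<in>carrier G. z \<otimes> y = y \<otimes> z; z [^] q = \<one>\<rbrakk> \<Longrightarrow> z = \<one>"
  shows "\<lbrakk>x \<in> upper_central_series G (Suc n); x [^] (q::nat) \<in> upper_central_series G n\<rbrakk>
    \<Longrightarrow> x \<in> upper_central_series G n"
proof (induction n arbitrary: x)
  case 0
  thus ?case using center[of x] by (auto simp: commutator_eq_one_iff)
next
  case (Suc n)
  let ?Z = "upper_central_series G n"
  let ?Q = "G Mod ?Z"
  interpret Z: normal ?Z G by (rule upper_central_series_normal)
  interpret Q: group "?Q" by (rule Z.factorgroup_is_group)
  have x: "x \<in> carrier G" using Suc.prems by simp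
  have "x \<otimes> y \<otimes> inv x \<otimes> inv y \<in> ?Z" if y: "y \<in> carrier G" for y
  proof (rule Suc.IH)
    define c where "c = x \<otimes> y \<otimes> inv x \<otimes> inv y"
    have cZ: "c \<in> upper_central_series G (Suc n)" using Suc.prems y unfolding c_def by simp
    have c: "c \<in> carrier G" using x y by (simp add: c_def)
    let ?X = "?Z #> x" and ?Y = "?Z #> y" and ?C = "?Z #> c"
    have car: "?X \<in> carrier (?Q)" "?Y \<in> carrier (?Q)" "?C \<in> carrier (?Q)"
      using x y c by (auto simp: carrier_FactGroup)
    have "x \<otimes> y = c \<otimes> y \<otimes> x" using x y by (simp add: c_def m_assoc)
    hence "?X \<otimes>\<^bsub>?Q\<^esub> ?Y = ?C \<otimes>\<^bsub>?Q\<^esub> ?Y \<otimes>\<^bsub>?Q\<^esub> ?X"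
      using x y c by (simp add: Z.rcos_sum)
    moreover have "?C \<otimes>\<^bsub>?Q\<^esub> ?X = ?X \<otimes>\<^bsub>?Q\<^esub> ?C"
      using cZ x c Z.commutator_mem_iff by auto
    ultimately have "?X [^]\<^bsub>?Q\<^esub> q \<otimes>\<^bsub>?Q\<^esub> ?Y
        = ?C [^]\<^bsub>?Q\<^esub> q \<otimes>\<^bsub>?Q\<^esub> ?Y \<otimes>\<^bsub>?Q\<^esub> ?X [^]\<^bsub>?Q\<^esub> q"
      by (intro Q.commutator_power car)
    moreover have "?X [^]\<^bsub>?Q\<^esub> q \<otimes>\<^bsub>?Q\<^esub> ?Y = ?Y \<otimes>\<^bsub>?Q\<^esub> ?X [^]\<^bsub>?Q\<^esub> q"
      using Suc.prems(2) y x Z.commutator_mem_iff[of "x [^] q" y] by (simp add: Z.FactGroup_pow)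
    ultimately have "?C [^]\<^bsub>?Q\<^esub> q \<otimes>\<^bsub>?Q\<^esub> (?Y \<otimes>\<^bsub>?Q\<^esub> ?X [^]\<^bsub>?Q\<^esub> q)
        = ?Y \<otimes>\<^bsub>?Q\<^esub> ?X [^]\<^bsub>?Q\<^esub> q"
      using car by (simp only: Q.m_assoc Q.nat_pow_closed)
    hence "?C [^]\<^bsub>?Q\<^esub> q = \<one>\<^bsub>?Q\<^esub>"
      using Q.r_cancel_one[of "?Y \<otimes>\<^bsub>?Q\<^esub> ?X [^]\<^bsub>?Q\<^esub> q" "?C [^]\<^bsub>?Q\<^esub> q"] car
      by (simp only: Q.m_closed Q.nat_pow_closed)
    thus "(x \<otimes> y \<otimes> inv x \<otimes> inv y) [^] q \<in> ?Z"
      using c Z.rcos_eq_self_iff[of "c [^] q"] by (simp add: Z.FactGroup_pow c_def)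
    show "x \<otimes> y \<otimes> inv x \<otimes> inv y \<in> upper_central_series G (Suc n)"
      using cZ c_def by simp
  qed
  thus ?case using x by simp
qed

text \<open>An element of order \<open>q\<close> would otherwise descend along the upper central series from the whole
  group to the trivial subgroup.\<close>

lemma nilpotent_central_torsion:
  fixes G (structure)
  assumes nil: "nilpotent_group G" and fin: "finite (carrier G)"
    and q: "Factorial_Ring.prime q" "q dvd card (carrier G)"
  shows "\<exists>z\<in>carrier G. z \<noteq> \<one> \<and> z [^] q = \<one> \<and> (\<forall>y\<in>carrier G. z \<otimes> y = y \<otimes> z)"
proof (rule ccontr)
  assume none: "\<not> ?thesis"
  interpret group G using nil by (simp add: nilpotent_group_def)
  obtain n where n: "lower_central_series G n = {\<one>}" using nil by (auto simp: nilpotent_group_def)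
  obtain x where x: "x \<in> carrier G" "x \<noteq> \<one>" "x [^] q = \<one>" using cauchy[OF fin q] by auto
  have "x \<in> upper_central_series G (n - i)" for i
  proof (induction i)
    case 0
    show ?case using lower_central_series_subset_upper[OF n order.refl] x by auto
  next
    case (Suc i)
    show ?case
    proof (cases "i < n")
      case True
      hence "x \<in> upper_central_series G (Suc (n - Suc i))" using Suc by (simp add: Suc_diff_Suc)
      moreover have "x [^] q \<in> upper_central_series G (n - Suc i)"
        using x subgroup.one_closed[OF normal_imp_subgroup[OF upper_central_series_normal]] by simp
      ultimately show ?thesis using upper_central_series_torsion[of q] none by blast
    next
      case False
      thus ?thesis using Suc by simp
    qed
  qed
  from this[of n] show False using x by simp
qed

section \<open>The Fitting subgroup\<close>

text \<open>The elements \<open>x\<close> of the centre of \<open>N\<close> with \<open>x\<^sup>q = \<one>\<close> form a characteristic subgroup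
  of \<open>N\<close>, nontrivial by the preceding lemma and of \<open>q\<close>-power order.\<close>

lemma (in group) nilpotent_normal_imp_normal_prime_power:
  assumes fin: "finite (carrier G)" and q: "Factorial_Ring.prime q"
    and N: "N \<lhd> G" "nilpotent_group (G\<lparr>carrier := N\<rparr>)" "q dvd card N"
  shows "\<exists>R k. R \<lhd> G \<and> R \<noteq> {\<one>} \<and> card R = q ^ k"
proof -
  interpret N: normal N G by (rule N)
  define R where "R = {x \<in> N. x [^] q = \<one> \<and> (\<forall>y\<in>N. x \<otimes> y = y \<otimes> x)}"
  have RN: "\<And>a. a \<in> R \<Longrightarrow> a \<in> N" and Rq: "\<And>a. a \<in> R \<Longrightarrow> a [^] q = \<one>"
    and Rc: "\<And>a y. \<lbrakk>a \<in> R; y \<in> N\<rbrakk> \<Longrightarrow> a \<otimes> y = y \<otimes> a"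
    unfolding R_def by blast+
  have RI: "a \<in> R" if "a \<in> N" "a [^] q = \<one>" "\<And>y. y \<in> N \<Longrightarrow> a \<otimes> y = y \<otimes> a" for a
    using that unfolding R_def by blast
  have sub: "subgroup R G"
  proof (rule subgroupI)
    have "\<one> \<in> R" by (rule RI) simp_all
    thus "R \<noteq> {}" by blast
    show "R \<subseteq> carrier G" using RN by auto
  next
    fix a b assume a: "a \<in> R" and b: "b \<in> R"
    show "a \<otimes> b \<in> R"
    proof (rule RI)
      show "a \<otimes> b \<in> N" using a b RN by blast
      show "(a \<otimes> b) [^] q = \<one>"
        using pow_mult_distrib[OF Rc[OF a RN[OF b]]] RN[OF a] RN[OF b] Rq[OF a] Rq[OF b] by simp
    qed (use RN a b Rc in \<open>intro commutes_mult, auto\<close>)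
  next
    fix a assume a: "a \<in> R"
    show "inv a \<in> R"
    proof (rule RI)
      show "inv a \<in> N" using a RN by blast
      show "inv a [^] q = \<one>" using RN[OF a] Rq[OF a] by (simp add: nat_pow_inv)
    qed (use RN a Rc in \<open>intro commutes_inv, auto\<close>)
  qed
  have "R \<lhd> G"
  proof (rule normal_invI[OF sub])
    fix g r assume g: "g \<in> carrier G" and r: "r \<in> R"
    have rc: "r \<in> carrier G" using RN[OF r] by simp
    show "g \<otimes> r \<otimes> inv g \<in> R"
    proof (rule RI)
      show "g \<otimes> r \<otimes> inv g \<in> N" using N.inv_op_closed2[OF g RN[OF r]] .
      have "inv g \<otimes> (g \<otimes> z) = z" if "z \<in> carrier G" for z
        using that g by (simp add: m_assoc[symmetric])
      hence "(g \<otimes> r \<otimes> inv g) [^] (j::nat) = g \<otimes> r [^] j \<otimes> inv g" for j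
        by (induction j) (use g rc in \<open>simp_all add: m_assoc\<close>)
      thus "(g \<otimes> r \<otimes> inv g) [^] q = \<one>" using Rq[OF r] g by simp
      fix y assume y: "y \<in> N"
      show "(g \<otimes> r \<otimes> inv g) \<otimes> y = y \<otimes> (g \<otimes> r \<otimes> inv g)"
        using Rc[OF r N.inv_op_closed1[OF g y]] y by (intro conj_commutes[OF g rc]) simp_all
    qed
  qed
  moreover have "R \<noteq> {\<one>}"
  proof -
    obtain z where z: "z \<in> N" "z \<noteq> \<one>" "z [^]\<^bsub>G\<lparr>carrier := N\<rparr>\<^esub> q = \<one>" "\<forall>y\<in>N. z \<otimes> y = y \<otimes> z"
      using nilpotent_central_torsion[OF N(2) _ q] N(3) finite_subset[OF N.subset fin] by auto
    hence "z \<in> R" using RI[of z] nat_pow_consistent[of z q N] by metis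
    thus ?thesis using z(2) by blast
  qed
  moreover have "\<exists>k. card (carrier (G\<lparr>carrier := R\<rparr>)) = q ^ k"
  proof (rule group.exponent_prime_imp_card_prime_power[OF subgroup_imp_group[OF sub] _ q])
    show "finite (carrier (G\<lparr>carrier := R\<rparr>))" using finite_subset[OF subgroup.subset[OF sub] fin] by simp
    fix x assume "x \<in> carrier (G\<lparr>carrier := R\<rparr>)"
    thus "x [^]\<^bsub>G\<lparr>carrier := R\<rparr>\<^esub> q = \<one>\<^bsub>G\<lparr>carrier := R\<rparr>\<^esub>"
      using nat_pow_consistent[of x q R] Rq by simp
  qed
  ultimately show ?thesis by auto
qed

text \<open>This needs no nilpotency of the Fitting subgroup: if there is no nontrivial normal \<open>q\<close>-subgroup,
  then every nilpotent normal subgroup has order coprime to \<open>q\<close>, and all of these lie in any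
  subgroup that is maximal among the normal subgroups of order coprime to \<open>q\<close>.\<close>

lemma (in group) prime_dvd_fitting_imp_normal_prime_power:
  assumes fin: "finite (carrier G)" and q: "Factorial_Ring.prime q"
    and dvd: "q dvd card (fitting_subgroup G)"
  shows "\<exists>R k. R \<lhd> G \<and> R \<noteq> {\<one>} \<and> card R = q ^ k"
proof (rule ccontr)
  assume none: "\<not> ?thesis"
  define S where "S = {M. M \<lhd> G \<and> \<not> q dvd card M}"
  have "S \<subseteq> Pow (carrier G)"
    using normal_imp_subgroup subgroup.subset by (force simp: S_def)
  hence finS: "finite S" using fin finite_subset by blast
  have "{\<one>} \<in> S" using one_is_normal q by (auto simp: S_def)
  then obtain M where M: "M \<in> S" and max: "\<And>L. \<lbrakk>L \<in> S; M \<subseteq> L\<rbrakk> \<Longrightarrow> L = M"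
    using finite_has_maximal2[OF finS] by metis
  have MG: "M \<lhd> G" using M by (simp add: S_def)
  have "N \<subseteq> M" if N: "N \<lhd> G" "nilpotent_group (G\<lparr>carrier := N\<rparr>)" for N
  proof -
    interpret second_isomorphism_grp M G N
      using MG N normal_imp_subgroup
      by (simp add: second_isomorphism_grp_def second_isomorphism_grp_axioms_def)
    have "\<not> q dvd card N"
      using nilpotent_normal_imp_normal_prime_power[OF fin q N] none by blast
    hence "\<not> q dvd card M * card N"
      using M q by (simp add: S_def prime_dvd_mult_iff)
    hence "\<not> q dvd card (M <#> N)"
      using card_normal_set_mult_dvd[OF MG subgrpS] dvd_trans by blast
    hence "M <#> N \<in> S" using normal_subgroup_set_mult_closed[OF MG N(1)] by (simp add: S_def)
    hence "M <#> N = M" using max H_contained_in_set_mult by blast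
    thus ?thesis using S_contained_in_set_mult by simp
  qed
  hence U: "\<Union>{N. N \<lhd> G \<and> nilpotent_group (G\<lparr>carrier := N\<rparr>)} \<subseteq> M" by auto
  have Msub: "subgroup M G" using MG by (rule normal_imp_subgroup)
  have "card (fitting_subgroup G) dvd card M"
    unfolding fitting_subgroup_def
    using U subgroup.subset[OF Msub] Msub
    by (intro card_subgroup_dvd generate_is_subgroup generate_subgroup_incl) auto
  thus False using dvd M dvd_trans by (auto simp: S_def)
qed

section \<open>Core-free maximal subgroups\<close>

lemma (in group) maximal_supplement:
  assumes max: "maximal_subgroup H G" and A: "A \<lhd> G" "\<not> A \<subseteq> H" and g: "g \<in> carrier G"
  shows "\<exists>a\<in>A. \<exists>h\<in>H. g = a \<otimes> h"
proof -
  have H: "subgroup H G" using max by (simp add: maximal_subgroup_def)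
  interpret second_isomorphism_grp A G H
    using A H by (simp add: second_isomorphism_grp_def second_isomorphism_grp_axioms_def)
  have "A <#> H \<noteq> H" using H_contained_in_set_mult A(2) by auto
  hence "A <#> H = carrier G"
    using max normal_set_mult_subgroup S_contained_in_set_mult
    unfolding maximal_subgroup_def by blast
  hence "g \<in> A <#> H" using g by simp
  thus ?thesis unfolding set_mult_def by blast
qed

lemma (in group) normal_if_conj_closed_factors:
  assumes AH: "\<And>g. g \<in> carrier G \<Longrightarrow> \<exists>a\<in>A. \<exists>h\<in>H. g = a \<otimes> h"
    and sub: "A \<subseteq> carrier G" "H \<subseteq> carrier G" "subgroup M G"
    and A: "\<And>a m. \<lbrakk>a \<in> A; m \<in> M\<rbrakk> \<Longrightarrow> a \<otimes> m \<otimes> inv a \<in> M"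
    and H: "\<And>h m. \<lbrakk>h \<in> H; m \<in> M\<rbrakk> \<Longrightarrow> h \<otimes> m \<otimes> inv h \<in> M"
  shows "M \<lhd> G"
proof (rule normal_invI[OF sub(3)])
  fix g m assume "g \<in> carrier G" and m: "m \<in> M"
  then obtain a h where ah: "a \<in> A" "h \<in> H" and g: "g = a \<otimes> h" using AH by blast
  have car: "a \<in> carrier G" "h \<in> carrier G" "m \<in> carrier G"
    using ah m sub subgroup.mem_carrier by auto
  have "g \<otimes> m \<otimes> inv g = a \<otimes> (h \<otimes> m \<otimes> inv h) \<otimes> inv a"
    using car g by (simp add: inv_mult_group m_assoc)
  thus "g \<otimes> m \<otimes> inv g \<in> M" using A[OF ah(1) H[OF ah(2) m]] by simp
qed

text \<open>The situation in \<open>G / Core\<^sub>G H\<close>: \<open>H\<close> is a maximal subgroup without nontrivial normal subgroups of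
  \<open>G\<close>, \<open>A\<close> is an abelian minimal normal subgroup of \<open>G\<close>, and \<open>R\<close> is a nontrivial normal
  \<open>q\<close>-subgroup of \<open>H\<close>.\<close>

locale core_free_maximal = group G for G (structure) +
  fixes H A R :: "'a set" and q :: nat
  assumes fin: "finite (carrier G)"
    and max: "maximal_subgroup H G"
    and core_free: "\<And>M. \<lbrakk>M \<lhd> G; M \<subseteq> H\<rbrakk> \<Longrightarrow> M = {\<one>}"
    and A: "A \<lhd> G" "A \<noteq> {\<one>}"
    and A_comm: "\<And>a b. \<lbrakk>a \<in> A; b \<in> A\<rbrakk> \<Longrightarrow> a \<otimes> b = b \<otimes> a"
    and A_min: "\<And>M. \<lbrakk>M \<lhd> G; M \<subseteq> A; M \<noteq> {\<one>}\<rbrakk> \<Longrightarrow> M = A"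
    and q: "Factorial_Ring.prime q"
    and R: "R \<lhd> G\<lparr>carrier := H\<rparr>" "R \<noteq> {\<one>}" "\<exists>k. card R = q ^ k"
begin

lemma H: "subgroup H G"
  using max by (simp add: maximal_subgroup_def)

lemma R_subgroup: "subgroup R G" and R_subset: "R \<subseteq> H"
  using incl_subgroup[OF H normal_imp_subgroup[OF R(1)]]
    subgroup.subset[OF normal_imp_subgroup[OF R(1)]] by auto

lemma R_conj: assumes "h \<in> H" "r \<in> R" shows "h \<otimes> r \<otimes> inv h \<in> R"
  using normal.inv_op_closed2[OF R(1), of h r] assms m_inv_consistent[OF H] by simp

lemma A_sub: "subgroup A G" using A(1) by (rule normal_imp_subgroup)

lemma A_car: "a \<in> A \<Longrightarrow> a \<in> carrier G" using A_sub subgroup.mem_carrier by fast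
lemma H_car: "h \<in> H \<Longrightarrow> h \<in> carrier G" using H subgroup.mem_carrier by fast
lemma R_car: "r \<in> R \<Longrightarrow> r \<in> carrier G" using R_subset H_car by auto

lemma A_conj: "\<lbrakk>g \<in> carrier G; a \<in> A\<rbrakk> \<Longrightarrow> g \<otimes> a \<otimes> inv g \<in> A"
  by (rule normal.inv_op_closed2[OF A(1)])

lemma factor: assumes "g \<in> carrier G" obtains a h where "a \<in> A" "h \<in> H" "g = a \<otimes> h"
  using maximal_supplement[OF max A(1) _ assms] core_free[OF A(1)] A(2) by blast

lemma normalI_factors:
  assumes "subgroup M G" "\<And>a m. \<lbrakk>a \<in> A; m \<in> M\<rbrakk> \<Longrightarrow> a \<otimes> m \<otimes> inv a \<in> M"
    and "\<And>h m. \<lbrakk>h \<in> H; m \<in> M\<rbrakk> \<Longrightarrow> h \<otimes> m \<otimes> inv h \<in> M"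
  shows "M \<lhd> G"
proof (rule normal_if_conj_closed_factors[of A H, OF _ subgroup.subset[OF A_sub] subgroup.subset[OF H] assms])
  show "\<exists>a\<in>A. \<exists>h\<in>H. g = a \<otimes> h" if "g \<in> carrier G" for g
    using factor[OF that] by blast
qed

text \<open>\<open>A \<inter> H\<close> is normalized by \<open>H\<close> and centralized by \<open>A\<close>, hence normal in \<open>A H = G\<close>.\<close>

lemma A_Int_H: "A \<inter> H = {\<one>}"
proof (rule core_free)
  show "A \<inter> H \<lhd> G"
  proof (rule normalI_factors)
    show "subgroup (A \<inter> H) G" by (rule subgroups_Inter_pair[OF A_sub H])
    show "a \<otimes> m \<otimes> inv a \<in> A \<inter> H" if "a \<in> A" "m \<in> A \<inter> H" for a m
      using that conj_eq_self[of a m] A_comm A_car by auto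
    show "h \<otimes> m \<otimes> inv h \<in> A \<inter> H" if "h \<in> H" "m \<in> A \<inter> H" for h m
      using that A_conj H_car subgroup.m_closed[OF H] subgroup.m_inv_closed[OF H] by auto
  qed
qed simp

lemma centralizer_A_in_H: "{x \<in> H. \<forall>a\<in>A. x \<otimes> a = a \<otimes> x} = {\<one>}" (is "?C = _")
proof (rule core_free)
  show "?C \<lhd> G"
  proof (rule normalI_factors)
    show "subgroup ?C G" by (rule subgroup_centralizer[OF H subgroup.subset[OF A_sub]])
    show "a \<otimes> m \<otimes> inv a \<in> ?C" if "a \<in> A" "m \<in> ?C" for a m
    proof -
      have "a \<otimes> m \<otimes> inv a = m"
        using that by (intro conj_eq_self A_car H_car) auto
      thus ?thesis using that(2) by simp
    qed
    show "h \<otimes> m \<otimes> inv h \<in> ?C" if h: "h \<in> H" and m: "m \<in> ?C" for h m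
    proof -
      have "h \<otimes> m \<otimes> inv h \<in> H" using h m subgroup.m_closed[OF H] subgroup.m_inv_closed[OF H] by auto
      moreover have "(h \<otimes> m \<otimes> inv h) \<otimes> a = a \<otimes> (h \<otimes> m \<otimes> inv h)" if a: "a \<in> A" for a
        using m h a normal.inv_op_closed1[OF A(1) H_car[OF h] a]
        by (intro conj_commutes) (auto intro: A_car H_car)
      ultimately show ?thesis by blast
    qed
  qed
qed auto

text \<open>The centralizer of \<open>R\<close> in \<open>A\<close> is normal in \<open>A H = G\<close>; it cannot be all of \<open>A\<close>, because no
  nontrivial element of \<open>H\<close> centralizes \<open>A\<close>.\<close>

lemma centralizer_R_in_A: "{a \<in> A. \<forall>r\<in>R. a \<otimes> r = r \<otimes> a} = {\<one>}" (is "?C = _")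
proof (rule ccontr)
  assume nt: "?C \<noteq> {\<one>}"
  have "?C \<lhd> G"
  proof (rule normalI_factors)
    show "subgroup ?C G" by (rule subgroup_centralizer[OF A_sub subgroup.subset[OF R_subgroup]])
    show "a \<otimes> m \<otimes> inv a \<in> ?C" if "a \<in> A" "m \<in> ?C" for a m
    proof -
      have "a \<otimes> m \<otimes> inv a = m"
        using that A_comm by (intro conj_eq_self A_car) auto
      thus ?thesis using that(2) by simp
    qed
    show "h \<otimes> m \<otimes> inv h \<in> ?C" if h: "h \<in> H" and m: "m \<in> ?C" for h m
    proof -
      have "h \<otimes> m \<otimes> inv h \<in> A" using h m A_conj H_car by auto
      moreover have "(h \<otimes> m \<otimes> inv h) \<otimes> r = r \<otimes> (h \<otimes> m \<otimes> inv h)" if r: "r \<in> R" for r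
      proof (rule conj_commutes)
        have "inv h \<otimes> r \<otimes> h \<in> R"
          using R_conj[OF subgroup.m_inv_closed[OF H h] r] H_car[OF h] by simp
        thus "m \<otimes> (inv h \<otimes> r \<otimes> h) = (inv h \<otimes> r \<otimes> h) \<otimes> m" using m by blast
      qed (use h m r in \<open>auto intro: A_car H_car R_car\<close>)
      ultimately show ?thesis by blast
    qed
  qed
  hence eq: "?C = A" by (rule A_min) (use nt in blast)+
  have "r \<otimes> a = a \<otimes> r" if "r \<in> R" "a \<in> A" for r a
  proof -
    have "a \<in> ?C" unfolding eq by (rule that(2))
    hence "a \<otimes> r = r \<otimes> a" using that(1) by blast
    thus ?thesis by (rule sym)
  qed
  hence "R \<subseteq> {x \<in> H. \<forall>a\<in>A. x \<otimes> a = a \<otimes> x}" using R_subset by blast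
  hence "R \<subseteq> {\<one>}" using centralizer_A_in_H by simp
  thus False using R(2) subgroup.one_closed[OF R_subgroup] by blast
qed

text \<open>Conjugation by \<open>R\<close> on \<open>A\<close> fixes only \<open>\<one>\<close>, so \<open>|A|\<close> is congruent to \<open>1\<close> modulo \<open>q\<close>.\<close>

lemma prime_not_dvd_card_A: "\<not> q dvd card A"
proof
  assume dvd: "q dvd card A"
  obtain k where k: "card R = q ^ k" using R(3) by blast
  have finA: "finite A" using fin subgroup.subset[OF A_sub] finite_subset by blast
  have "q dvd card (A - {a \<in> A. \<forall>r\<in>R. r \<otimes> a = a \<otimes> r})"
    using A_conj R_car
    by (intro prime_dvd_card_noncentralized[OF q R_subgroup k finA subgroup.subset[OF A_sub]]) auto
  moreover have "{a \<in> A. \<forall>r\<in>R. r \<otimes> a = a \<otimes> r} = {a \<in> A. \<forall>r\<in>R. a \<otimes> r = r \<otimes> a}"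
    by (rule Collect_cong) metis
  hence "{a \<in> A. \<forall>r\<in>R. r \<otimes> a = a \<otimes> r} = {\<one>}" using centralizer_R_in_A by simp
  moreover have "card (A - {\<one>}) = card A - 1"
    using subgroup.one_closed[OF A_sub] by simp
  moreover have "card A > 0" using finA subgroup.one_closed[OF A_sub] card_gt_0_iff by blast
  ultimately have "q dvd card A - (card A - 1)" using dvd dvd_diff_nat by metis
  hence "q dvd 1" using \<open>card A > 0\<close> by simp
  thus False using q by simp
qed

lemma index_coprime: "\<exists>t. card (carrier G) = card H * t \<and> \<not> q dvd t"
proof -
  obtain t where t: "card (carrier G) = card H * t"
    using card_subgroup_dvd[OF H subgroup_self subgroup.subset[OF H]] by (auto simp: dvd_def)
  have pos: "card H > 0" using subgroup.finite_imp_card_positive[OF H fin] .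
  have "g \<in> A <#> H" if "g \<in> carrier G" for g
    using factor[OF that] unfolding set_mult_def by blast
  hence "A <#> H = carrier G"
    using set_mult_closed[OF subgroup.subset[OF A_sub] subgroup.subset[OF H]] by blast
  hence "card H * t dvd card H * card A"
    using card_normal_set_mult_dvd[OF A(1) H] t by (simp add: mult.commute)
  hence "t dvd card A" using pos by (metis nat_mult_dvd_cancel1)
  thus ?thesis using t prime_not_dvd_card_A dvd_trans by blast
qed

text \<open>Write \<open>g = a h\<close>. Since \<open>R\<close> is normal in \<open>H\<close>, the conjugates of the elements \<open>r\<close> of \<open>R\<close> by \<open>a\<close> stay
  in \<open>H\<close>, so \<open>[a, r] \<in> A \<inter> H = 1\<close>.\<close>

lemma normalizing_imp_mem:
  assumes Q: "R \<subseteq> Q" "Q \<subseteq> H" and g: "g \<in> carrier G"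
    and norm: "\<And>x. x \<in> Q \<Longrightarrow> g \<otimes> x \<otimes> inv g \<in> Q"
  shows "g \<in> H"
proof -
  obtain a h where a: "a \<in> A" and h: "h \<in> H" and gah: "g = a \<otimes> h" using factor[OF g] .
  have ac: "a \<in> carrier G" and hc: "h \<in> carrier G" using a h A_car H_car by auto
  have "a \<otimes> r = r \<otimes> a" if r: "r \<in> R" for r
  proof -
    have rc: "r \<in> carrier G" using r R_car by simp
    have "inv h \<otimes> r \<otimes> h \<in> R"
      using R_conj[OF subgroup.m_inv_closed[OF H h] r] hc by simp
    hence "g \<otimes> (inv h \<otimes> r \<otimes> h) \<otimes> inv g \<in> H" using norm Q by blast
    also have "g \<otimes> (inv h \<otimes> r \<otimes> h) \<otimes> inv g
        = a \<otimes> ((h \<otimes> inv h) \<otimes> r \<otimes> (h \<otimes> inv h)) \<otimes> inv a"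
      using ac hc rc by (simp only: gah inv_mult_group m_assoc m_closed inv_closed)
    also have "\<dots> = a \<otimes> r \<otimes> inv a" using ac hc rc by simp
    finally have "a \<otimes> r \<otimes> inv a \<otimes> inv r \<in> H"
      using r R_subset subgroup.m_closed[OF H] subgroup.m_inv_closed[OF H] by blast
    moreover have "a \<otimes> r \<otimes> inv a \<otimes> inv r = a \<otimes> (r \<otimes> inv a \<otimes> inv r)"
      using ac rc by (simp add: m_assoc)
    hence "a \<otimes> r \<otimes> inv a \<otimes> inv r \<in> A"
      using A_conj[OF rc] a subgroup.m_closed[OF A_sub] subgroup.m_inv_closed[OF A_sub] by simp
    ultimately have "a \<otimes> r \<otimes> inv a \<otimes> inv r = \<one>" using A_Int_H by blast
    thus ?thesis using commutator_eq_one_iff[OF ac rc] by simp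
  qed
  hence "a = \<one>" using a centralizer_R_in_A by blast
  thus ?thesis using gah h hc by simp
qed

end

text \<open>The last nontrivial term of the derived series is abelian and normal; take a minimal nontrivial
  normal subgroup of \<open>G\<close> inside it.\<close>

lemma (in group) abelian_normal_minimal:
  assumes fin: "finite (carrier G)" and sol: "solvable G" and nt: "carrier G \<noteq> {\<one>}"
  obtains A where "A \<lhd> G" "A \<noteq> {\<one>}" "\<And>a b. \<lbrakk>a \<in> A; b \<in> A\<rbrakk> \<Longrightarrow> a \<otimes> b = b \<otimes> a"
    "\<And>M. \<lbrakk>M \<lhd> G; M \<subseteq> A; M \<noteq> {\<one>}\<rbrakk> \<Longrightarrow> M = A"
proof -
  define D where "D n = (derived G ^^ n) (carrier G)" for n
  have DN: "D n \<lhd> G" for n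
    by (induction n) (simp_all add: D_def normal_self derived_is_normal)
  have ex: "\<exists>n. D n = {\<one>}" using sol solvable_iff_trivial_derived_seq by (simp add: D_def)
  define n where "n = (LEAST n. D n = {\<one>})"
  have n: "D n = {\<one>}" using LeastI_ex[OF ex] by (simp add: n_def)
  have "n \<noteq> 0" using n nt by (intro notI) (simp add: D_def)
  then obtain m where m: "n = Suc m" using not0_implies_Suc by blast
  have Dm: "D m \<noteq> {\<one>}" using not_less_Least[of m "\<lambda>n. D n = {\<one>}"] m n_def by simp
  have Dsub: "D m \<subseteq> carrier G" using normal_imp_subgroup[OF DN] subgroup.subset by blast
  have comm: "a \<otimes> b = b \<otimes> a" if "a \<in> D m" "b \<in> D m" for a b
  proof -
    have "a \<otimes> b \<otimes> inv a \<otimes> inv b \<in> derived G (D m)"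
      unfolding derived_def using that by (intro generate.incl) auto
    hence "a \<otimes> b \<otimes> inv a \<otimes> inv b = \<one>" using n m by (simp add: D_def)
    thus ?thesis using commutator_eq_one_iff[of a b] that Dsub by auto
  qed
  define S where "S = {M. M \<lhd> G \<and> M \<noteq> {\<one>} \<and> M \<subseteq> D m}"
  have "S \<subseteq> Pow (carrier G)" using Dsub by (auto simp: S_def)
  hence "finite S" using fin finite_subset by blast
  moreover have "D m \<in> S" using DN Dm by (simp add: S_def)
  ultimately obtain A where A: "A \<in> S" "\<forall>M\<in>S. M \<le> A \<longrightarrow> A = M"
    using finite_has_minimal[of S] by blast
  hence An: "A \<lhd> G" "A \<noteq> {\<one>}" and AD: "A \<subseteq> D m" unfolding S_def by blast+
  show thesis
  proof (rule that[OF An])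
    show "a \<otimes> b = b \<otimes> a" if "a \<in> A" "b \<in> A" for a b using comm AD that by blast
    show "M = A" if "M \<lhd> G" "M \<subseteq> A" "M \<noteq> {\<one>}" for M
    proof -
      have "M \<in> S" using that AD unfolding S_def by blast
      thus ?thesis using A(2) that(2) by blast
    qed
  qed
qed

section \<open>The normal core\<close>

lemma (in group) mem_conj_iff:
  assumes g: "g \<in> carrier G" and H: "H \<subseteq> carrier G" and x: "x \<in> carrier G"
  shows "x \<in> inv g <# H #> g \<longleftrightarrow> g \<otimes> x \<otimes> inv g \<in> H"
proof
  assume "x \<in> inv g <# H #> g"
  then obtain h where h: "h \<in> H" "x = inv g \<otimes> h \<otimes> g"
    by (auto simp: l_coset_def r_coset_def)
  moreover have "h \<in> carrier G" using h H by auto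
  hence "g \<otimes> (inv g \<otimes> h \<otimes> g) \<otimes> inv g = (g \<otimes> inv g) \<otimes> h \<otimes> (g \<otimes> inv g)"
    using g by (simp only: m_assoc m_closed inv_closed)
  hence "g \<otimes> x \<otimes> inv g = h" using h g \<open>h \<in> carrier G\<close> by simp
  ultimately show "g \<otimes> x \<otimes> inv g \<in> H" by simp
next
  assume h: "g \<otimes> x \<otimes> inv g \<in> H"
  have "inv g \<otimes> (g \<otimes> x \<otimes> inv g) \<otimes> g = (inv g \<otimes> g) \<otimes> x \<otimes> (inv g \<otimes> g)"
    using g x by (simp only: m_assoc m_closed inv_closed)
  hence "x = inv g \<otimes> (g \<otimes> x \<otimes> inv g) \<otimes> g" using g x by simp
  thus "x \<in> inv g <# H #> g" using h unfolding l_coset_def r_coset_def by blast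
qed

lemma (in group) mem_normal_core_iff:
  assumes H: "subgroup H G"
  shows "x \<in> normal_core G H \<longleftrightarrow> x \<in> carrier G \<and> (\<forall>g\<in>carrier G. g \<otimes> x \<otimes> inv g \<in> H)"
proof -
  have "inv \<one> <# H #> \<one> \<subseteq> carrier G"
    using subgroup.subset[OF H] by (simp add: lcos_mult_one)
  hence "normal_core G H \<subseteq> carrier G" unfolding normal_core_def by fast
  moreover have "x \<in> normal_core G H \<longleftrightarrow> (\<forall>g\<in>carrier G. g \<otimes> x \<otimes> inv g \<in> H)"
    if "x \<in> carrier G"
    using mem_conj_iff[OF _ subgroup.subset[OF H] that] by (simp add: normal_core_def)
  ultimately show ?thesis by blast
qed

lemma (in group) normal_core_subset:
  assumes "subgroup H G"
  shows "normal_core G H \<subseteq> H"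
proof
  fix x assume "x \<in> normal_core G H"
  hence "x \<in> carrier G" "\<one> \<otimes> x \<otimes> inv \<one> \<in> H"
    unfolding mem_normal_core_iff[OF assms] by blast+
  thus "x \<in> H" by simp
qed

lemma (in group) normal_core_greatest:
  assumes H: "subgroup H G" and M: "M \<lhd> G" "M \<subseteq> H"
  shows "M \<subseteq> normal_core G H"
proof
  fix x assume x: "x \<in> M"
  have "g \<otimes> x \<otimes> inv g \<in> H" if "g \<in> carrier G" for g
    using normal.inv_op_closed2[OF M(1) that x] M(2) by blast
  moreover have "x \<in> carrier G" using x M(2) subgroup.subset[OF H] by blast
  ultimately show "x \<in> normal_core G H" unfolding mem_normal_core_iff[OF H] by blast
qed

lemma (in group) normal_core_normal:
  assumes H: "subgroup H G"
  shows "normal_core G H \<lhd> G" (is "?C \<lhd> G")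
proof (rule normal_invI)
  show "subgroup ?C G"
  proof (rule subgroupI)
    show "?C \<subseteq> carrier G" unfolding mem_normal_core_iff[OF H] subset_iff by blast
    have "g \<otimes> \<one> \<otimes> inv g \<in> H" if "g \<in> carrier G" for g
      using that subgroup.one_closed[OF H] by simp
    hence "\<one> \<in> ?C" unfolding mem_normal_core_iff[OF H] by blast
    thus "?C \<noteq> {}" by blast
  next
    fix a assume a: "a \<in> ?C"
    hence ac: "a \<in> carrier G" unfolding mem_normal_core_iff[OF H] by blast
    have "g \<otimes> inv a \<otimes> inv g \<in> H" if g: "g \<in> carrier G" for g
    proof -
      have "inv (g \<otimes> a \<otimes> inv g) \<in> H"
        using a g subgroup.m_inv_closed[OF H] unfolding mem_normal_core_iff[OF H] by blast
      thus ?thesis using g ac by (simp add: inv_mult_group m_assoc)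
    qed
    thus "inv a \<in> ?C" using ac unfolding mem_normal_core_iff[OF H] by blast
  next
    fix a b assume a: "a \<in> ?C" and b: "b \<in> ?C"
    hence ac: "a \<in> carrier G" "b \<in> carrier G" unfolding mem_normal_core_iff[OF H] by blast+
    have "g \<otimes> (a \<otimes> b) \<otimes> inv g \<in> H" if g: "g \<in> carrier G" for g
    proof -
      have "(g \<otimes> a \<otimes> inv g) \<otimes> (g \<otimes> b \<otimes> inv g) \<in> H"
        using a b g subgroup.m_closed[OF H] unfolding mem_normal_core_iff[OF H] by blast
      also have "(g \<otimes> a \<otimes> inv g) \<otimes> (g \<otimes> b \<otimes> inv g) = g \<otimes> a \<otimes> (inv g \<otimes> g) \<otimes> b \<otimes> inv g"
        using g ac by (simp only: m_assoc m_closed inv_closed)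
      finally show ?thesis using g ac by (simp add: m_assoc)
    qed
    thus "a \<otimes> b \<in> ?C" using ac unfolding mem_normal_core_iff[OF H] by blast
  qed
next
  fix k x assume k: "k \<in> carrier G" and x: "x \<in> ?C"
  hence xc: "x \<in> carrier G" unfolding mem_normal_core_iff[OF H] by blast
  have "g \<otimes> (k \<otimes> x \<otimes> inv k) \<otimes> inv g \<in> H" if g: "g \<in> carrier G" for g
  proof -
    have "(g \<otimes> k) \<otimes> x \<otimes> inv (g \<otimes> k) \<in> H"
      using x g k unfolding mem_normal_core_iff[OF H] by blast
    thus ?thesis using g k xc by (simp add: inv_mult_group m_assoc)
  qed
  thus "k \<otimes> x \<otimes> inv k \<in> ?C" using k xc unfolding mem_normal_core_iff[OF H] by blast
qed

section \<open>Quotient groups\<close>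

lemma (in normal) card_preimage:
  assumes "subgroup S (G Mod H)"
  shows "card (\<Union>S) = card H * card S"
proof -
  have sub: "subgroup (\<Union>S) G" by (rule factgroup_subgroup_union_subgroup[OF assms])
  have eq: "S = rcosets\<^bsub>G\<lparr>carrier := \<Union>S\<rparr>\<^esub> H"
    by (rule factgroup_subgroup_union_factor[OF assms])
  have "H \<in> S" using subgroup.one_closed[OF assms] by simp
  hence "subgroup H (G\<lparr>carrier := \<Union>S\<rparr>)"
    by (intro subgroup_incl[OF subgroup_axioms sub]) auto
  from group.lagrange[OF subgroup_imp_group[OF sub] this] show ?thesis
    unfolding eq[symmetric] by (simp add: order_def mult.commute)
qed

lemma (in normal) rcos_mem_image_iff:
  assumes K: "subgroup K G" "H \<subseteq> K" and x: "x \<in> carrier G"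
  shows "H #> x \<in> (\<lambda>y. H #> y) ` K \<longleftrightarrow> x \<in> K"
proof
  assume "H #> x \<in> (\<lambda>y. H #> y) ` K"
  then obtain y where y: "y \<in> K" "H #> x = H #> y" by blast
  hence "x \<in> H #> y" using rcos_self[OF x subgroup_axioms] by simp
  then obtain h where h: "h \<in> H" "x = h \<otimes> y" unfolding r_coset_def by blast
  thus "x \<in> K" using y K subgroup.m_closed[OF K(1)] by blast
qed blast

lemma (in normal) subgroup_image_Mod:
  assumes "subgroup K G"
  shows "subgroup ((\<lambda>x. H #> x) ` K) (G Mod H)"
proof -
  have "group_hom G (G Mod H) (\<lambda>x. H #> x)"
    using factorgroup_is_group r_coset_hom_Mod
    by (simp add: group_hom_def group_hom_axioms_def is_group)
  thus ?thesis using assms by (rule group_hom.subgroup_img_is_subgroup)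
qed

lemma (in normal) maximal_subgroup_image_Mod:
  assumes max: "maximal_subgroup K G" and HK: "H \<subseteq> K"
  shows "maximal_subgroup ((\<lambda>x. H #> x) ` K) (G Mod H)"
  unfolding maximal_subgroup_def
proof (intro conjI allI impI)
  let ?f = "\<lambda>x. H #> x"
  have K: "subgroup K G" using max by (simp add: maximal_subgroup_def)
  show "subgroup (?f ` K) (G Mod H)" by (rule subgroup_image_Mod[OF K])
  show "?f ` K \<noteq> carrier (G Mod H)"
  proof
    assume eq: "?f ` K = carrier (G Mod H)"
    have "x \<in> K" if x: "x \<in> carrier G" for x
    proof -
      have "?f x \<in> ?f ` K" unfolding eq carrier_FactGroup using x by blast
      thus ?thesis using rcos_mem_image_iff[OF K HK x] by simp
    qed
    thus False using max subgroup.subset[OF K] unfolding maximal_subgroup_def by blast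
  qed
  fix L assume "subgroup L (G Mod H) \<and> ?f ` K \<subseteq> L"
  hence L: "subgroup L (G Mod H)" and KL: "?f ` K \<subseteq> L" by auto
  have UL: "\<Union>L = {x \<in> carrier G. ?f x \<in> L}" by (rule factgroup_subgroup_union_char[OF L])
  have Lim: "L = ?f ` \<Union>L"
    using subgroup.subset[OF L] unfolding UL carrier_FactGroup by blast
  have "K \<subseteq> \<Union>L" unfolding UL using KL subgroup.subset[OF K] by blast
  hence "\<Union>L = K \<or> \<Union>L = carrier G"
    using max factgroup_subgroup_union_subgroup[OF L] unfolding maximal_subgroup_def by blast
  thus "L = ?f ` K \<or> L = carrier (G Mod H)"
    using Lim by (auto simp: carrier_FactGroup)
qed

section \<open>Normalizers of Sylow subgroups of a maximal subgroup\<close>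

lemma (in group) mem_normalizer_imp:
  assumes Q: "subgroup Q G" and g: "g \<in> normalizer G Q"
  shows "g \<in> carrier G" and "x \<in> Q \<Longrightarrow> g \<otimes> x \<otimes> inv g \<in> Q"
proof -
  show gc: "g \<in> carrier G" using g by (simp add: normalizer_def stabilizer_def)
  have eq: "g <# Q #> inv g = Q"
    using g subgroup.subset[OF Q] by (simp add: normalizer_def stabilizer_def)
  assume "x \<in> Q"
  hence "g \<otimes> x \<otimes> inv g \<in> g <# Q #> inv g" unfolding l_coset_def r_coset_def by blast
  thus "g \<otimes> x \<otimes> inv g \<in> Q" using eq by simp
qed

theorem theorem1:
  fixes G :: "('a, 'b) monoid_scheme" and H :: "'a set" and q :: nat
  assumes "group G" and "finite (carrier G)" and "solvable G"
    and "maximal_subgroup H G" and "\<not> H \<lhd> G"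
    and "q \<in> prime_factors
               (card (fitting_subgroup ((G\<lparr>carrier := H\<rparr>) Mod (normal_core G H))))"
  shows "\<exists>Q. sylow_subgroup G q Q \<and> normalizer G Q \<subseteq> H"
proof -
  interpret group G by fact
  have fin: "finite (carrier G)" and max: "maximal_subgroup H G" by fact+
  have H: "subgroup H G" using max by (simp add: maximal_subgroup_def)
  have q: "Factorial_Ring.prime q" using assms(6) by auto
  define C where "C = normal_core G H"
  have CH: "C \<subseteq> H" using normal_core_subset[OF H] by (simp add: C_def)
  interpret C: normal C G unfolding C_def by (rule normal_core_normal[OF H])
  define f where "f x = C #>\<^bsub>G\<^esub> x" for x
  let ?G' = "G Mod C" and ?H' = "f ` H"
  have f: "f = (\<lambda>x. C #>\<^bsub>G\<^esub> x)" by (simp add: fun_eq_iff f_def)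
  interpret G': group ?G' by (rule C.factorgroup_is_group)
  interpret fh: group_hom G ?G' f
    using C.r_coset_hom_Mod unfolding f by unfold_locales
  have f_surj: "f ` carrier G = carrier ?G'" by (simp add: carrier_FactGroup f)
  have fin': "finite (carrier ?G')" using fin f_surj by (metis finite_imageI)
  have max': "maximal_subgroup ?H' ?G'"
    unfolding f by (rule C.maximal_subgroup_image_Mod[OF max CH])
  hence H': "subgroup ?H' ?G'" by (simp add: maximal_subgroup_def)
  have mem: "x \<in> K" if "subgroup K G" "C \<subseteq> K" "x \<in> carrier G" "f x \<in> f ` K" for x K
    using C.rcos_mem_image_iff[OF that(1-3)] that(4) by (simp add: f)
  \<comment> \<open>The two quotients agree as records because multiplication of sets does not see the carrier.\<close>
  have quot: "(G\<lparr>carrier := H\<rparr>) Mod C = ?G'\<lparr>carrier := ?H'\<rparr>"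
    by (auto simp: FactGroup_def RCOSETS_def f fun_eq_iff set_mult_def)
  have fin_H': "finite ?H'" using fin' subgroup.subset[OF H'] finite_subset by blast
  obtain R k where R: "R \<lhd> ?G'\<lparr>carrier := ?H'\<rparr>" "R \<noteq> {\<one>\<^bsub>?G'\<^esub>}" "card R = q ^ k"
    using group.prime_dvd_fitting_imp_normal_prime_power[OF G'.subgroup_imp_group[OF H'] _ q]
      assms(6) fin_H' by (auto simp: quot C_def[symmetric])
  have nt: "carrier ?G' \<noteq> {\<one>\<^bsub>?G'\<^esub>}"
  proof
    assume "carrier ?G' = {\<one>\<^bsub>?G'\<^esub>}"
    hence "?H' = carrier ?G'" using subgroup.subset[OF H'] subgroup.one_closed[OF H'] by auto
    thus False using max' by (simp add: maximal_subgroup_def)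
  qed
  have sol: "solvable ?G'" using fh.surj_hom_imp_solvable[OF f_surj] assms(3) .
  obtain A where A: "A \<lhd> ?G'" "A \<noteq> {\<one>\<^bsub>?G'\<^esub>}"
    "\<And>a b. \<lbrakk>a \<in> A; b \<in> A\<rbrakk> \<Longrightarrow> a \<otimes>\<^bsub>?G'\<^esub> b = b \<otimes>\<^bsub>?G'\<^esub> a"
    "\<And>M. \<lbrakk>M \<lhd> ?G'; M \<subseteq> A; M \<noteq> {\<one>\<^bsub>?G'\<^esub>}\<rbrakk> \<Longrightarrow> M = A"
    by (rule G'.abelian_normal_minimal[OF fin' sol nt]) (rule that; simp)
  interpret P: core_free_maximal ?G' ?H' A R q
  proof (intro core_free_maximal.intro core_free_maximal_axioms.intro)
    fix M assume M: "M \<lhd> ?G'" "M \<subseteq> ?H'"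
    have Msub: "subgroup M ?G'" using M(1) by (rule normal_imp_subgroup)
    have UM: "\<Union>M = {x \<in> carrier G. f x \<in> M}"
      unfolding f by (rule C.factgroup_subgroup_union_char[OF Msub])
    have "\<Union>M \<subseteq> H" unfolding UM using mem[OF H CH] M(2) by blast
    hence "\<Union>M \<subseteq> C"
      using normal_core_greatest[OF H C.factgroup_subgroup_union_normal[OF M(1)]] by (simp add: C_def)
    have "m = C" if m: "m \<in> M" for m
    proof -
      obtain x where x: "x \<in> carrier G" "m = f x"
        using m subgroup.subset[OF Msub] f_surj by blast
      hence "x \<in> C" using \<open>\<Union>M \<subseteq> C\<close> UM m by blast
      thus ?thesis using x C.rcos_eq_self_iff[OF x(1)] by (simp add: f)
    qed
    hence "M \<subseteq> {\<one>\<^bsub>?G'\<^esub>}" by simp blast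
    thus "M = {\<one>\<^bsub>?G'\<^esub>}" using subgroup.one_closed[OF Msub] by blast
  next
    show "\<exists>k. card R = q ^ k" using R(3) by (rule exI)
  qed (assumption | rule G'.group_axioms fin' max' A q R(1,2))+
  \<comment> \<open>The index of \<open>H\<close> in \<open>G\<close> is that of \<open>H / C\<close>, hence prime to \<open>q\<close>, so a Sylow \<open>q\<close>-subgroup of \<open>H\<close> is one of \<open>G\<close>.\<close>
  obtain t where t: "card (carrier ?G') = card ?H' * t" "\<not> q dvd t"
    using P.index_coprime by blast
  have cH: "card H = card C * card ?H'"
  proof -
    have "\<Union>?H' = H"
      unfolding C.factgroup_subgroup_union_char[OF H']
      using mem[OF H CH] subgroup.subset[OF H] by (auto simp: f)
    thus ?thesis using C.card_preimage[OF H'] by simp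
  qed
  have cG: "card (carrier G) = card H * t"
    using lagrange[OF C.subgroup_axioms] t(1) cH by (simp add: order_def FactGroup_def mult_ac)
  define m where "m = multiplicity q (card H)"
  have cpos: "card H > 0" "card (carrier G) > 0"
    using subgroup.finite_imp_card_positive[OF H fin] fin by (auto simp: card_gt_0_iff)
  obtain s where s: "card H = q ^ m * s" "\<not> q dvd s"
    unfolding m_def
  proof (rule multiplicity_decompose'[of "card H" q])
    show "card H \<noteq> 0" using cpos by simp
    show "\<not> is_unit q" using q by (auto dest: not_prime_unit)
  qed
  obtain Q where Q: "subgroup Q (G\<lparr>carrier := H\<rparr>)" "card Q = q ^ m"
    using sylow_thm[OF q subgroup_imp_group[OF H], of m s] s(1) fin
      finite_subset[OF subgroup.subset[OF H]] by (auto simp: order_def)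
  have QG: "subgroup Q G" and QH: "Q \<subseteq> H"
    using incl_subgroup[OF H Q(1)] subgroup.subset[OF Q(1)] by auto
  have "card (carrier G) = q ^ m * (s * t)" "\<not> q dvd s * t"
    using cG s t q by (auto simp: prime_dvd_mult_iff)
  hence "multiplicity q (order G) = m"
    unfolding order_def using q by (intro multiplicity_decomposeI[of _ _ _ "s * t"]) auto
  hence syl: "sylow_subgroup G q Q"
    using q QG Q(2) by (simp add: sylow_subgroup_def)
  have Q': "subgroup (f ` Q) ?G'" unfolding f by (rule C.subgroup_image_Mod[OF QG])
  \<comment> \<open>The preimage \<open>Q C\<close> of \<open>f ` Q\<close> contains \<open>Q\<close>, so \<open>f ` Q\<close> has index coprime to \<open>q\<close> in \<open>f ` H\<close>.\<close>
  have RQ: "R \<subseteq> f ` Q"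
  proof -
    have sub: "subgroup (\<Union>(f ` Q)) G" by (rule C.factgroup_subgroup_union_subgroup[OF Q'])
    have UQ: "\<Union>(f ` Q) = {x \<in> carrier G. f x \<in> f ` Q}"
      unfolding f by (rule C.factgroup_subgroup_union_char[OF Q'[unfolded f]])
    have "Q \<subseteq> \<Union>(f ` Q)" unfolding UQ using subgroup.subset[OF QG] by blast
    then obtain v where v: "card (\<Union>(f ` Q)) = card Q * v"
      using card_subgroup_dvd[OF QG sub] by (auto simp: dvd_def)
    obtain u where u: "card ?H' = card (f ` Q) * u"
      using G'.card_subgroup_dvd[OF Q' H' image_mono[OF QH]] by (auto simp: dvd_def)
    have "card H = card Q * (v * u)"
      using cH u v C.card_preimage[OF Q'] by (simp add: mult.assoc)
    hence "s = v * u" using s(1) Q(2) prime_gt_0_nat[OF q] by simp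
    hence "\<not> q dvd u" using s(2) by auto
    interpret H'g: group "?G'\<lparr>carrier := ?H'\<rparr>" by (rule G'.subgroup_imp_group[OF H'])
    show ?thesis
    proof (rule H'g.normal_prime_power_subset[OF _ q R(1,3)])
      show "subgroup (f ` Q) (?G'\<lparr>carrier := ?H'\<rparr>)"
        by (rule G'.subgroup_incl[OF Q' H' image_mono[OF QH]])
    qed (use fin_H' u \<open>\<not> q dvd u\<close> in auto)
  qed
  have "normalizer G Q \<subseteq> H"
  proof
    fix g assume g: "g \<in> normalizer G Q"
    have gc: "g \<in> carrier G" by (rule mem_normalizer_imp(1)[OF QG g])
    have "f g \<in> ?H'"
    proof (rule P.normalizing_imp_mem[OF RQ image_mono[OF QH]])
      show "f g \<in> carrier ?G'" using gc by simp
      fix y assume "y \<in> f ` Q"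
      then obtain x where x: "x \<in> Q" "y = f x" by blast
      have "x \<in> carrier G" using x subgroup.mem_carrier[OF QG] by simp
      hence "f g \<otimes>\<^bsub>?G'\<^esub> y \<otimes>\<^bsub>?G'\<^esub> inv\<^bsub>?G'\<^esub> f g = f (g \<otimes>\<^bsub>G\<^esub> x \<otimes>\<^bsub>G\<^esub> inv\<^bsub>G\<^esub> g)"
        using gc x by (simp del: mult_FactGroup)
      thus "f g \<otimes>\<^bsub>?G'\<^esub> y \<otimes>\<^bsub>?G'\<^esub> inv\<^bsub>?G'\<^esub> f g \<in> f ` Q"
        using mem_normalizer_imp(2)[OF QG g x(1)] by simp
    qed
    thus "g \<in> H" by (rule mem[OF H CH gc])
  qed
  thus ?thesis using syl by blast
qed

end
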